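(* Let $r,D\ge 1$ be integers. Then $\Delta_{r,D}\ne 0$ if and only if $\Delta'_{r,D}\ne 0$. Consequently, the assertion "$\Delta_{r,D}\ne 0$ for all integers $r,D\ge 1$" is equivalent to the assertion "$\Delta'_{r,D}\ne 0$ for all integers $r,D\ge 1$".
   Context: The Bernoulli polynomials $B_n(x)$ are defined by $\frac{ze^{xz}}{e^z-1}=\sum_{n\ge 0}B_n(x)\frac{z^n}{n!}$. The falling factorial is $(y)_N=y(y-1)\cdots(y-N+1)$. $\Delta_{r,D}$ is the determinant of the $rD\times rD$ matrix whose rows are indexed by $n=0,1,\dots,rD-1$ (in this order), and whose $(mD+v)$-th column ($0\le m\le r-1$, $1\le v\le D$) has in row $n$ the entry $D^{n+m}\,\frac{B_{n+m+1}(v/D)}{n+m+1}$. For $1\le j\le r$, $0\le\ell\le r-1$ let $A_{j,\ell}(x)=(-1)^{r-1}\sum_{t=0}^{\ell}(-1)^t\binom rt(x+\ell-t)^{j-1}$ (with $(\cdot)^0=1$). Let $S_0(x)=(Dx)_{Dr}$ and $S_t(x)=(x-r)\left(x-\frac r2\right)^{t-1}(Dx)_{Dr}$ for $1\le t\le r-1$. For $1\le j\le r$, $0\le t\le r-1$ let $\Phi_{j,t}(x)=A_{j,0}(x)S_t(x)+A_{j,1}(x)S_t(x+1)+\cdots+A_{j,r-1}(x)S_t(x+r-1)$ and $I_{j,t}=\int_0^1\Phi_{j,t}(x)\,dx$. Then $\Delta'_{r,D}=\det(I_{j,t})_{1\le j\le r,\ 0\le t\le r-1}$. *)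

theory Defs
  imports
    "HOL-Analysis.Henstock_Kurzweil_Integration"
    "HOL-Computational_Algebra.Formal_Power_Series"
    "Jordan_Normal_Form.Determinant"
begin

text \<open>
  The Bernoulli polynomials, evaluated at a real point and read off from
  \<open>z * exp (x z) / (exp z - 1) = (\<Sum>n. B\<^sub>n(x) z^n / n!)\<close>. The quotient is the division of formal
  power series; numerator and denominator both have subdegree \<open>1\<close>, so it is exact
  (see the lemma below).
\<close>

definition bernoulli_gf :: "real \<Rightarrow> real fps" where
  "bernoulli_gf x = (fps_X * fps_exp x) / (fps_exp 1 - 1)"

definition bernoulli_poly :: "nat \<Rightarrow> real \<Rightarrow> real" where
  "bernoulli_poly n x = fact n * fps_nth (bernoulli_gf x) n"

lemma bernoulli_poly_gf:
  "Abs_fps (\<lambda>n. bernoulli_poly n x / fact n) * (fps_exp 1 - 1) = fps_X * fps_exp x"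
proof -
  have ne: "fps_nth (fps_exp (1::real) - 1) 1 \<noteq> 0"
    by simp
  have "subdegree (fps_exp (1::real) - 1) \<le> 1"
    by (rule subdegree_leI[OF ne])
  also have "1 \<le> subdegree (fps_X * fps_exp x)"
    by (rule subdegree_geI) auto
  finally have "(fps_exp (1::real) - 1) dvd (fps_X * fps_exp x)"
    using ne by (subst fps_dvd_iff) auto
  moreover have "Abs_fps (\<lambda>n. bernoulli_poly n x / fact n) = bernoulli_gf x"
    by (simp add: bernoulli_poly_def fps_eq_iff)
  ultimately show ?thesis
    by (simp add: bernoulli_gf_def)
qed

definition falling_fact :: "real \<Rightarrow> nat \<Rightarrow> real" where
  "falling_fact y N = (\<Prod>i<N. y - real i)"

text \<open>
  Matrix indices start at \<open>0\<close> here. The column with \<open>1\<close>-based number \<open>m D + v\<close>, where \<open>1 \<le> v \<le> D\<close>,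
  is therefore column \<open>c = m D + (v - 1)\<close>, so that \<open>m = c div D\<close> and \<open>v = c mod D + 1\<close>.
\<close>

definition Delta_mat :: "nat \<Rightarrow> nat \<Rightarrow> real mat" where
  "Delta_mat r D = mat (r * D) (r * D) (\<lambda>(n, c).
     let m = c div D; v = c mod D + 1
     in real D ^ (n + m) * (bernoulli_poly (n + m + 1) (real v / real D) / real (n + m + 1)))"

definition Delta :: "nat \<Rightarrow> nat \<Rightarrow> real" where
  "Delta r D = det (Delta_mat r D)"

text \<open>The index \<open>j\<close> starts at \<open>1\<close>: \<open>1 \<le> j \<le> r\<close>.\<close>

definition A_poly :: "nat \<Rightarrow> nat \<Rightarrow> nat \<Rightarrow> real \<Rightarrow> real" where
  "A_poly r j l x =
     (-1) ^ (r - 1) * (\<Sum>t\<le>l. (-1) ^ t * real (r choose t) * (x + real l - real t) ^ (j - 1))"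

definition S_poly :: "nat \<Rightarrow> nat \<Rightarrow> nat \<Rightarrow> real \<Rightarrow> real" where
  "S_poly r D t x =
     (if t = 0 then falling_fact (real D * x) (D * r)
      else (x - real r) * (x - real r / 2) ^ (t - 1) * falling_fact (real D * x) (D * r))"

definition Phi :: "nat \<Rightarrow> nat \<Rightarrow> nat \<Rightarrow> nat \<Rightarrow> real \<Rightarrow> real" where
  "Phi r D j t x = (\<Sum>l<r. A_poly r j l x * S_poly r D t (x + real l))"

definition I_entry :: "nat \<Rightarrow> nat \<Rightarrow> nat \<Rightarrow> nat \<Rightarrow> real" where
  "I_entry r D j t = integral {0..1} (Phi r D j t)"

text \<open>Row \<open>i\<close> of the matrix corresponds to \<open>j = i + 1\<close>.\<close>

definition Delta' :: "nat \<Rightarrow> nat \<Rightarrow> real" where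
  "Delta' r D = det (mat r r (\<lambda>(i, t). I_entry r D (i + 1) t))"

end

theory Submission
  imports Defs
begin

text \<open>
  Let \<open>L f\<close> be the polynomial with \<open>L f (x + 1) - L f x = f x\<close> and mean \<open>0\<close> on \<open>[0, 1]\<close>, so that
  \<open>L x\<^sup>k = B\<^bsub>k+1\<^esub>(x) / (k + 1)\<close>. A linear relation between the rows of the Bernoulli matrix is a
  polynomial \<open>Q \<noteq> 0\<close> of degree \<open>< r D\<close> such that \<open>L (x\<^sup>m Q)\<close> vanishes at \<open>v / D\<close> for all \<open>m < r\<close>
  and \<open>1 \<le> v \<le> D\<close>; by \<open>x \<mapsto> 1 - x\<close> one may take \<open>0 \<le> v < D\<close> instead.
  The combination \<open>\<Phi>\<^sub>j\<close> of \<open>S(x), \<dots>, S(x + r - 1)\<close> has difference \<open>x\<^bsup>j-1\<^esup> \<Delta>\<^sup>r S\<close>. Hence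
  \<open>\<Phi>\<^sub>j = L (x\<^bsup>j-1\<^esup> \<Delta>\<^sup>r S)\<close> as soon as \<open>\<integral>\<Phi>\<^sub>j = 0\<close>, which can be arranged for any given
  \<open>Q = \<Delta>\<^sup>r S\<close> by changing \<open>S\<close> by a polynomial of degree \<open>< r\<close>. As the matrix \<open>A\<^bsub>j,l\<^esub>(x)\<close> is invertible for every
  \<open>x\<close>, all \<open>\<Phi>\<^sub>j\<close> vanish at all \<open>v / D\<close> iff \<open>S\<close> vanishes at \<open>w / D\<close> for \<open>0 \<le> w < r D\<close>, i.e. iff \<open>S\<close> is
  a combination of \<open>S\<^sub>0, \<dots>, S\<^bsub>r-1\<^esub>\<close>; so such a \<open>Q\<close> amounts to a linear relation between the
  columns of \<open>(I\<^bsub>j,t\<^esub>)\<close>.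
\<close>

subsection \<open>Finite differences of polynomials\<close>

definition fdiff :: "real poly \<Rightarrow> real poly" where
  "fdiff p = p \<circ>\<^sub>p [:1, 1:] - p"

lemma poly_fdiff [simp]: "poly (fdiff p) x = poly p (x + 1) - poly p x"
  by (simp add: fdiff_def poly_pcompose add.commute)

lemma fdiff_diff: "fdiff (p - q) = fdiff p - fdiff q"
  by (simp add: fdiff_def pcompose_diff)

lemma fdiff_smult: "fdiff (smult c p) = smult c (fdiff p)"
  by (simp add: fdiff_def pcompose_smult smult_diff_right)

lemma fdiff_0 [simp]: "fdiff 0 = 0"
  by (simp add: fdiff_def)

lemma fdiff_sum: "fdiff (\<Sum>i\<in>A. f i) = (\<Sum>i\<in>A. fdiff (f i))"
  by (simp add: fdiff_def pcompose_sum sum_subtractf)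

text \<open>Invariance under the unit shift makes \<open>p\<close> take its value at 0 on all
  naturals, which are infinitely many points.\<close>

lemma fdiff_eq_0_imp_const:
  assumes "fdiff p = 0"
  shows "p = [:poly p 0:]"
proof -
  have step: "poly p (x + 1) = poly p x" for x
    using arg_cong[OF assms, of "\<lambda>q. poly q x"] by simp
  have "poly p (real n) = poly p 0" for n
  proof (induction n)
    case (Suc n)
    then show ?case using step[of "real n"] by (simp add: add.commute)
  qed simp
  then have "range real \<subseteq> {x. poly (p - [:poly p 0:]) x = 0}"
    by auto
  moreover have "infinite (range real)"
    by (simp add: finite_image_iff inj_on_def)
  ultimately have "infinite {x. poly (p - [:poly p 0:]) x = 0}"
    using finite_subset by blast
  then have "p - [:poly p 0:] = 0"
    using poly_roots_finite by blast
  then show ?thesis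
    by simp
qed

text \<open>Translation keeps the degree and the leading coefficient, so the top coefficients
  cancel.\<close>

lemma degree_fdiff_less:
  assumes "degree p > 0"
  shows "degree (fdiff p) < degree p"
proof -
  have deg: "degree (p \<circ>\<^sub>p [:1, 1:]) = degree p"
    by (simp add: degree_pcompose)
  have "lead_coeff (p \<circ>\<^sub>p [:1, 1:]) = lead_coeff p"
    by (subst lead_coeff_comp) auto
  then have "coeff (fdiff p) (degree p) = 0"
    using deg by (simp add: fdiff_def)
  moreover have "degree (fdiff p) \<le> degree p"
    unfolding fdiff_def by (rule degree_diff_le) (simp_all add: deg)
  ultimately show ?thesis
    using assms by (metis degree_0 le_neq_implies_less leading_coeff_0_iff)
qed

lemma degree_fdiff_funpow: "degree ((fdiff ^^ n) p) \<le> degree p - n"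
proof (induction n)
  case (Suc n)
  show ?case
  proof (cases "degree ((fdiff ^^ n) p) = 0")
    case True
    then obtain c where "(fdiff ^^ n) p = [:c:]"
      by (rule degree_eq_zeroE)
    then have "(fdiff ^^ Suc n) p = 0"
      by (simp add: fdiff_def)
    then show ?thesis
      by (simp del: funpow.simps)
  next
    case False
    then show ?thesis
      using degree_fdiff_less[of "(fdiff ^^ n) p"] Suc by simp
  qed
qed simp

lemma fdiff_funpow_eq_0:
  assumes "degree p < n"
  shows "(fdiff ^^ n) p = 0"
proof -
  obtain k where n: "n = Suc k"
    using assms by (cases n) auto
  have "degree ((fdiff ^^ k) p) = 0"
    using degree_fdiff_funpow[of k p] assms n by simp
  then obtain c where "(fdiff ^^ k) p = [:c:]"
    by (rule degree_eq_zeroE)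
  then show ?thesis
    by (simp add: n fdiff_def)
qed

text \<open>This expands (E - 1)^n with E the unit shift. The sign \<open>(-1) ^ (n + l)\<close>
  avoids the truncated \<open>n - l\<close>.\<close>

lemma poly_fdiff_funpow:
  "poly ((fdiff ^^ n) p) x = (\<Sum>l\<le>n. (-1) ^ (n + l) * real (n choose l) * poly p (x + real l))"
proof (induction n arbitrary: x)
  case (Suc n)
  let ?s = "\<lambda>l. (-1) ^ (n + l) * poly p (x + real l)"
  have "poly ((fdiff ^^ n) p) (x + 1) =
      (\<Sum>l\<le>n. (-1) ^ (n + l) * real (n choose l) * poly p (x + 1 + real l))"
    by (rule Suc)
  also have "\<dots> = - (\<Sum>l\<le>n. real (n choose l) * ?s (Suc l))"
    by (simp add: sum_negf[symmetric] ac_simps)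
  finally have 1: "poly ((fdiff ^^ n) p) (x + 1) = - (\<Sum>l\<le>n. real (n choose l) * ?s (Suc l))" .
  have "poly ((fdiff ^^ n) p) x = (\<Sum>l\<le>n. (-1) ^ (n + l) * real (n choose l) * poly p (x + real l))"
    by (rule Suc)
  also have "\<dots> = (\<Sum>l\<le>Suc n. real (n choose l) * ?s l)"
    by (simp add: ac_simps)
  also have "\<dots> = ?s 0 + (\<Sum>l\<le>n. real (n choose Suc l) * ?s (Suc l))"
    by (subst sum.atMost_Suc_shift) simp
  finally have 2: "poly ((fdiff ^^ n) p) x = ?s 0 + (\<Sum>l\<le>n. real (n choose Suc l) * ?s (Suc l))" .
  \<comment> \<open>Pascal's rule merges the two sums.\<close>
  have "poly ((fdiff ^^ Suc n) p) x =
      - (?s 0 + (\<Sum>l\<le>n. real (Suc n choose Suc l) * ?s (Suc l)))"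
    by (simp add: 1 2 sum.distrib distrib_right del: power_Suc add_Suc_right of_nat_Suc)
  also have "\<dots> = - (\<Sum>l\<le>Suc n. real (Suc n choose l) * ?s l)"
    by (subst sum.atMost_Suc_shift) simp
  also have "\<dots> = (\<Sum>l\<le>Suc n. (-1) ^ (Suc n + l) * real (Suc n choose l) * poly p (x + real l))"
    by (subst sum_negf[symmetric]) (rule sum.cong, auto)
  finally show ?case .
qed simp

subsection \<open>Integrals over the unit interval and Bernoulli polynomials\<close>

definition unit_integral :: "real poly \<Rightarrow> real" where
  "unit_integral p = integral {0..1} (poly p)"

lemma poly_integrable: "poly p integrable_on {0..1::real}"
  by (intro integrable_continuous_real continuous_intros)

lemma unit_integral_diff: "unit_integral (p - q) = unit_integral p - unit_integral q"
proof -
  have "poly (p - q) = (\<lambda>x. poly p x - poly q x)"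
    by auto
  then show ?thesis
    unfolding unit_integral_def by (simp add: integral_diff poly_integrable)
qed

lemma unit_integral_smult: "unit_integral (smult c p) = c * unit_integral p"
proof -
  have "poly (smult c p) = (\<lambda>x. c * poly p x)"
    by auto
  then show ?thesis
    unfolding unit_integral_def by simp
qed

lemma unit_integral_sum: "unit_integral (\<Sum>i\<in>A. f i) = (\<Sum>i\<in>A. unit_integral (f i))"
proof (cases "finite A")
  case True
  have "poly (\<Sum>i\<in>A. f i) = (\<lambda>x. \<Sum>i\<in>A. poly (f i) x)"
    by (auto simp: poly_sum)
  then show ?thesis
    unfolding unit_integral_def using True by (simp add: integral_sum poly_integrable)
next
  case False
  then show ?thesis
    using unit_integral_smult[of 0 0] by simp
qed

lemma unit_integral_const [simp]: "unit_integral [:c:] = c"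
proof -
  have "poly [:c:] = (\<lambda>x. c)"
    by auto
  then show ?thesis
    by (simp add: unit_integral_def)
qed

lemma unit_integral_pderiv: "unit_integral (pderiv p) = poly p 1 - poly p 0"
proof -
  have "(poly (pderiv p) has_integral poly p 1 - poly p 0) {0..1}"
    by (rule fundamental_theorem_of_calculus)
      (auto intro!: has_field_derivative_at_within poly_DERIV
        simp flip: has_real_derivative_iff_has_vector_derivative)
  then show ?thesis
    by (simp add: unit_integral_def integral_unique)
qed

section \<open>Bernoulli polynomials as polynomials in x\<close>

text \<open>The coefficients come from the Cauchy product of exp(x z) with the generating function
  at 0; see \<open>bernoulli_gf_factor\<close>.\<close>

definition bern :: "nat \<Rightarrow> real poly" where
  "bern n = (\<Sum>i\<le>n. monom (fact n / fact i * fps_nth (bernoulli_gf 0) (n - i)) i)"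

lemma bernoulli_gf_mult: "bernoulli_gf x * (fps_exp 1 - 1) = fps_X * fps_exp x"
proof -
  have "Abs_fps (\<lambda>n. bernoulli_poly n x / fact n) = bernoulli_gf x"
    by (simp add: bernoulli_poly_def fps_eq_iff)
  then show ?thesis
    using bernoulli_poly_gf[of x] by simp
qed

lemma fps_exp_minus_1_neq_0: "fps_exp (1::real) - 1 \<noteq> 0"
proof
  assume "fps_exp (1::real) - 1 = 0"
  then have "fps_nth (fps_exp (1::real) - 1) 1 = 0"
    by simp
  then show False
    by simp
qed

lemma bernoulli_gf_factor: "bernoulli_gf x = fps_exp x * bernoulli_gf 0"
proof -
  have "bernoulli_gf x * (fps_exp 1 - 1) = fps_exp x * bernoulli_gf 0 * (fps_exp 1 - 1)"
    using bernoulli_gf_mult[of x] bernoulli_gf_mult[of 0] by (simp add: mult.assoc mult.commute)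
  then show ?thesis
    using fps_exp_minus_1_neq_0 mult_cancel_right by blast
qed

lemma poly_bern: "poly (bern n) x = bernoulli_poly n x"
proof -
  have "poly (bern n) x = (\<Sum>i\<le>n. fact n * (x ^ i / fact i * fps_nth (bernoulli_gf 0) (n - i)))"
    unfolding bern_def poly_sum by (rule sum.cong) (auto simp: poly_monom)
  then show ?thesis
    by (simp add: bernoulli_poly_def bernoulli_gf_factor[of x] fps_mult_nth sum_distrib_left atLeast0AtMost)
qed

lemma coeff_bern:
  "coeff (bern n) i = (if i \<le> n then fact n / fact i * fps_nth (bernoulli_gf 0) (n - i) else 0)"
  by (simp add: bern_def coeff_sum)

lemma degree_bern: "degree (bern n) \<le> n"
  by (rule degree_le) (simp add: coeff_bern)

lemma pderiv_bern: "pderiv (bern (Suc n)) = smult (real (Suc n)) (bern n)"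
  by (rule poly_eqI) (auto simp: coeff_pderiv coeff_bern divide_simps fact_Suc simp del: of_nat_Suc)

text \<open>The shift multiplies the generating function by exp z, so the difference multiplies it
  by exp z - 1, leaving z exp(x z).\<close>

lemma fdiff_bern: "fdiff (bern (Suc n)) = smult (real (Suc n)) (monom 1 n)"
proof (rule poly_ext)
  fix x :: real
  have "bernoulli_gf (x + 1) - bernoulli_gf x = fps_X * fps_exp x"
    using bernoulli_gf_mult[of x] bernoulli_gf_factor[of x] bernoulli_gf_factor[of "x + 1"]
    by (simp add: fps_exp_add_mult algebra_simps)
  then have "fps_nth (bernoulli_gf (x + 1)) (Suc n) - fps_nth (bernoulli_gf x) (Suc n) = x ^ n / fact n"
    by (simp add: fps_sub_nth[symmetric] del: fps_sub_nth)
  then show "poly (fdiff (bern (Suc n))) x = poly (smult (real (Suc n)) (monom 1 n)) x"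
    by (simp add: poly_bern bernoulli_poly_def poly_monom right_diff_distrib[symmetric] del: of_nat_Suc)
qed

text \<open>Up to a factor, \<open>bern (Suc n)\<close> is the derivative of the next Bernoulli
  polynomial, whose values at 0 and 1 differ by a multiple of 0^(n+1).\<close>

lemma unit_integral_bern: "unit_integral (bern (Suc n)) = 0"
proof -
  have "real (Suc (Suc n)) * unit_integral (bern (Suc n)) = unit_integral (pderiv (bern (Suc (Suc n))))"
    by (simp add: pderiv_bern unit_integral_smult del: of_nat_Suc)
  also have "\<dots> = poly (fdiff (bern (Suc (Suc n)))) 0"
    by (simp add: unit_integral_pderiv)
  also have "\<dots> = 0"
    by (simp only: fdiff_bern) (simp add: poly_monom)
  finally show ?thesis
    by simp
qed

section \<open>The antidifference operator L\<close>

definition antidiff :: "real poly \<Rightarrow> real poly" where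
  "antidiff f = (\<Sum>k\<le>degree f. smult (coeff f k / real (Suc k)) (bern (Suc k)))"

lemma fdiff_antidiff: "fdiff (antidiff f) = f"
proof -
  have "fdiff (antidiff f) = (\<Sum>k\<le>degree f. monom (coeff f k) k)"
    by (simp add: antidiff_def fdiff_sum fdiff_smult fdiff_bern smult_monom del: of_nat_Suc)
  then show ?thesis
    by (simp add: poly_as_sum_of_monoms)
qed

lemma unit_integral_antidiff: "unit_integral (antidiff f) = 0"
  by (simp add: antidiff_def unit_integral_sum unit_integral_smult unit_integral_bern)

lemma degree_antidiff: "degree (antidiff f) \<le> Suc (degree f)"
  unfolding antidiff_def
  by (rule degree_sum_le) (auto intro!: order.trans[OF degree_smult_le] order.trans[OF degree_bern])

text \<open>Polynomials with equal differences differ by a constant, and the mean over the unit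
  interval detects that constant.\<close>

lemma antidiff_eqI:
  assumes "fdiff G = f" "unit_integral G = 0"
  shows "antidiff f = G"
proof -
  have "fdiff (antidiff f - G) = 0"
    by (simp add: fdiff_diff fdiff_antidiff assms)
  then obtain c where c: "antidiff f - G = [:c:]"
    using fdiff_eq_0_imp_const by metis
  have "unit_integral (antidiff f - G) = 0"
    by (simp add: unit_integral_diff unit_integral_antidiff assms)
  then show ?thesis
    using c by simp
qed

lemma antidiff_smult: "antidiff (smult c f) = smult c (antidiff f)"
  by (rule antidiff_eqI) (simp_all add: fdiff_smult fdiff_antidiff unit_integral_smult unit_integral_antidiff)

lemma degree_le_degree_fdiff: "degree p \<le> Suc (degree (fdiff p))"
proof -
  have "fdiff (p - antidiff (fdiff p)) = 0"
    by (simp add: fdiff_diff fdiff_antidiff)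
  then obtain c where "p - antidiff (fdiff p) = [:c:]"
    using fdiff_eq_0_imp_const by metis
  then have "p = antidiff (fdiff p) + [:c:]"
    by (simp add: algebra_simps)
  then show ?thesis
    using degree_antidiff[of "fdiff p"] by (metis degree_add_le degree_pCons_0 le0)
qed

text \<open>This will show that Q = \<Delta>^r S is nonzero. Each antidifference raises the degree
  by at most one; the alternative \<open>p = 0\<close> is needed for \<open>n = 0\<close>.\<close>

lemma fdiff_funpow_eq_0D:
  assumes "(fdiff ^^ n) p = 0"
  shows "p = 0 \<or> degree p < n"
  using assms
proof (induction n arbitrary: p)
  case (Suc n)
  from Suc.prems have "(fdiff ^^ n) (fdiff p) = 0"
    by (simp add: funpow_swap1)
  from Suc.IH[OF this] show ?case
  proof
    assume "fdiff p = 0"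
    then have "p = [:poly p 0:]"
      by (rule fdiff_eq_0_imp_const)
    then show ?thesis
      by (metis degree_pCons_0 zero_less_Suc)
  next
    assume "degree (fdiff p) < n"
    then show ?thesis
      using degree_le_degree_fdiff[of p] by simp
  qed
qed simp

lemma fdiff_funpow_antidiff: "(fdiff ^^ n) ((antidiff ^^ n) f) = f"
  by (induction n arbitrary: f) (simp_all add: funpow_swap1[of antidiff] fdiff_antidiff)

lemma degree_antidiff_funpow: "degree ((antidiff ^^ n) f) \<le> degree f + n"
proof (induction n)
  case (Suc n)
  then show ?case
    using degree_antidiff[of "(antidiff ^^ n) f"] by simp
qed simp

section \<open>The reflection of x to 1 - x\<close>

lemma unit_integral_reflect: "unit_integral (p \<circ>\<^sub>p [:1, -1:]) = unit_integral p"
proof -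
  \<comment> \<open>\<open>P\<close> is an antiderivative of \<open>p\<close>; then -P(1 - x) is one
    of p(1 - x), with the same increment over the unit interval.\<close>
  define P where "P = (\<Sum>i\<le>degree p. monom (coeff p i / real (Suc i)) (Suc i))"
  have "pderiv P = (\<Sum>i\<le>degree p. monom (coeff p i) i)"
    by (simp add: P_def higher_pderiv_sum[of 1, simplified] pderiv_monom del: of_nat_Suc)
  then have P: "pderiv P = p"
    by (simp add: poly_as_sum_of_monoms)
  have "pderiv (- (P \<circ>\<^sub>p [:1, -1:])) = p \<circ>\<^sub>p [:1, -1:]"
    by (simp add: pderiv_minus pderiv_pcompose P pderiv_pCons)
  then have "unit_integral (p \<circ>\<^sub>p [:1, -1:]) = P' 1 - P' 0" if "P' = poly (- (P \<circ>\<^sub>p [:1, -1:]))" for P'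
    using unit_integral_pderiv[of "- (P \<circ>\<^sub>p [:1, -1:])"] that by simp
  then show ?thesis
    using unit_integral_pderiv[of P] by (simp add: P poly_pcompose)
qed

text \<open>For G = L f the difference of G(1 - x) is G(-x) - G(1 - x) = -f(-x), and reflection
  preserves the mean 0.\<close>

lemma antidiff_reflect: "antidiff (- (f \<circ>\<^sub>p [:0, -1:])) = antidiff f \<circ>\<^sub>p [:1, -1:]"
proof (rule antidiff_eqI)
  have "poly (fdiff (antidiff f)) (-x) = poly f (-x)" for x
    by (simp add: fdiff_antidiff)
  then have "poly (antidiff f) (- x) - poly (antidiff f) (1 - x) = - poly f (- x)" for x
    by (simp add: algebra_simps)
  then show "fdiff (antidiff f \<circ>\<^sub>p [:1, -1:]) = - (f \<circ>\<^sub>p [:0, -1:])"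
    by (intro poly_ext) (simp add: poly_pcompose)
  show "unit_integral (antidiff f \<circ>\<^sub>p [:1, -1:]) = 0"
    by (simp add: unit_integral_reflect unit_integral_antidiff)
qed

lemma poly_antidiff_monom_reflect:
  "poly (antidiff (monom 1 m * (Q \<circ>\<^sub>p [:0, -1:]))) x = (-1) ^ Suc m * poly (antidiff (monom 1 m * Q)) (1 - x)"
proof -
  have "monom 1 m * (Q \<circ>\<^sub>p [:0, -1:]) = smult ((-1) ^ Suc m) (- ((monom 1 m * Q) \<circ>\<^sub>p [:0, -1:]))"
  proof (rule poly_ext)
    fix y :: real
    show "poly (monom 1 m * (Q \<circ>\<^sub>p [:0, -1:])) y =
        poly (smult ((-1) ^ Suc m) (- ((monom 1 m * Q) \<circ>\<^sub>p [:0, -1:]))) y"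
      by (simp add: poly_pcompose poly_monom power_minus[of y m])
  qed
  then show ?thesis
    by (simp only: antidiff_smult antidiff_reflect) (simp add: poly_pcompose)
qed

subsection \<open>Linear algebra\<close>

lemma det_mat_eq_0_iff:
  fixes f :: "nat \<times> nat \<Rightarrow> 'a :: field"
  shows "det (mat n n f) = 0 \<longleftrightarrow> (\<exists>c. (\<exists>j<n. c j \<noteq> 0) \<and> (\<forall>i<n. (\<Sum>j<n. f (i, j) * c j) = 0))"
proof -
  have eq: "(mat n n f *\<^sub>v v = 0\<^sub>v n) \<longleftrightarrow> (\<forall>i<n. (\<Sum>j<n. f (i, j) * v $ j) = 0)" if "v \<in> carrier_vec n" for v
    using that by (auto simp: vec_eq_iff scalar_prod_def lessThan_atLeast0)
  have "det (mat n n f) = 0 \<longleftrightarrow> (\<exists>v. v \<in> carrier_vec n \<and> v \<noteq> 0\<^sub>v n \<and> mat n n f *\<^sub>v v = 0\<^sub>v n)"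
    by (rule det_0_iff_vec_prod_zero_field) simp
  also have "\<dots> \<longleftrightarrow> (\<exists>c. (\<exists>j<n. c j \<noteq> 0) \<and> (\<forall>i<n. (\<Sum>j<n. f (i, j) * c j) = 0))"
  proof safe
    fix v assume "v \<in> carrier_vec n" "v \<noteq> 0\<^sub>v n" "mat n n f *\<^sub>v v = 0\<^sub>v n"
    then show "\<exists>c. (\<exists>j<n. c j \<noteq> 0) \<and> (\<forall>i<n. (\<Sum>j<n. f (i, j) * c j) = 0)"
      using eq by (intro exI[of _ "\<lambda>j. v $ j"]) (auto simp: vec_eq_iff)
  next
    fix c j assume "\<forall>i<n. (\<Sum>j<n. f (i, j) * c j) = 0" "j < n" "c j \<noteq> 0"
    then show "\<exists>v. v \<in> carrier_vec n \<and> v \<noteq> 0\<^sub>v n \<and> mat n n f *\<^sub>v v = 0\<^sub>v n"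
      using eq[of "vec n c"] by (intro exI[of _ "vec n c"]) (auto simp: vec_eq_iff)
  qed
  finally show ?thesis .
qed

lemma det_mat_neq_0_imp_solvable:
  fixes f :: "nat \<times> nat \<Rightarrow> 'a :: field"
  assumes "det (mat n n f) \<noteq> 0"
  shows "\<exists>c. \<forall>i<n. (\<Sum>j<n. f (i, j) * c j) = b i"
proof -
  let ?A = "mat n n f"
  have "?A \<in> Units (ring_mat TYPE('a) n undefined)"
    using assms by (intro det_non_zero_imp_unit) auto
  then obtain B where B: "B \<in> carrier_mat n n" "?A * B = 1\<^sub>m n"
    unfolding Units_def ring_mat_def by auto
  have "?A *\<^sub>v (B *\<^sub>v vec n b) = vec n b"
    using B by (subst assoc_mult_mat_vec[symmetric, of _ n n _ n]) auto
  then have "(?A *\<^sub>v (B *\<^sub>v vec n b)) $ i = b i" if "i < n" for i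
    using that by simp
  then have "(\<Sum>j<n. f (i, j) * (B *\<^sub>v vec n b) $ j) = b i" if "i < n" for i
    using that B by (simp add: scalar_prod_def lessThan_atLeast0)
  then show ?thesis
    by (intro exI[of _ "\<lambda>j. (B *\<^sub>v vec n b) $ j"]) simp
qed

section \<open>Families with one polynomial of each degree\<close>

text \<open>Subtracting a multiple of the top member removes the leading coefficient. The
  alternative \<open>q = 0\<close> lets the induction start at \<open>n = 0\<close>.\<close>

lemma degree_basis_span:
  fixes b :: "nat \<Rightarrow> 'a :: field poly"
  assumes "\<And>t. t < n \<Longrightarrow> b t \<noteq> 0 \<and> degree (b t) = t" "q = 0 \<or> degree q < n"
  shows "\<exists>c. q = (\<Sum>t<n. smult (c t) (b t))"
  using assms
proof (induction n arbitrary: q)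
  case (Suc n)
  define a where "a = coeff q n / lead_coeff (b n)"
  define q' where "q' = q - smult a (b n)"
  have b: "b n \<noteq> 0" "degree (b n) = n"
    using Suc.prems(1) by auto
  have "coeff q' i = 0" if "i \<ge> n" for i
  proof (cases "i = n")
    case True
    have "coeff (b n) n \<noteq> 0"
      using b leading_coeff_0_iff[of "b n"] by simp
    then show ?thesis
      using b True by (simp add: q'_def a_def)
  next
    case False
    then show ?thesis
      using Suc.prems(2) b that by (auto simp: q'_def coeff_eq_0)
  qed
  then have "q' = 0 \<or> degree q' < n"
    by (metis leading_coeff_0_iff not_le)
  with Suc.IH[of q'] Suc.prems(1) obtain c where c: "q' = (\<Sum>t<n. smult (c t) (b t))"
    by auto
  have "q = (\<Sum>t<Suc n. smult ((c(n := a)) t) (b t))"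
    using c by (simp add: q'_def algebra_simps)
  then show ?case
    by blast
qed auto

lemma degree_basis_independent:
  fixes b :: "nat \<Rightarrow> 'a :: field poly"
  assumes "\<And>t. t < n \<Longrightarrow> b t \<noteq> 0 \<and> degree (b t) = t" "(\<Sum>t<n. smult (c t) (b t)) = 0" "t < n"
  shows "c t = 0"
  using assms
proof (induction n)
  case (Suc n)
  have b: "b n \<noteq> 0" "degree (b n) = n"
    using Suc.prems(1) by auto
  have "coeff (smult (c t) (b t)) n = 0" if "t < n" for t
    using Suc.prems(1)[of t] that by (simp add: coeff_eq_0)
  then have "coeff (\<Sum>t<Suc n. smult (c t) (b t)) n = c n * coeff (b n) n"
    by (simp add: coeff_sum del: coeff_smult) simp
  then have "c n * coeff (b n) n = 0"
    by (simp only: Suc.prems(2) coeff_0)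
  then have "c n = 0"
    using b leading_coeff_0_iff[of "b n"] by simp
  then show ?case
    using Suc by (auto simp: less_Suc_eq)
qed simp

lemma degree_sum_basis_less:
  fixes b :: "nat \<Rightarrow> 'a :: field poly"
  assumes "\<And>t. t < n \<Longrightarrow> degree (b t) = t" "n > 0"
  shows "degree (\<Sum>t<n. smult (c t) (b t)) < n"
proof -
  have "degree (\<Sum>t<n. smult (c t) (b t)) \<le> n - 1"
    using assms by (intro degree_sum_le) (auto intro!: order.trans[OF degree_smult_le])
  then show ?thesis
    using assms by simp
qed

subsection \<open>The polynomials \<open>\<Phi>\<^sub>j\<close>\<close>

definition A_pol :: "nat \<Rightarrow> nat \<Rightarrow> nat \<Rightarrow> real poly" where
  "A_pol r m l = smult ((-1) ^ (r - 1))
     (\<Sum>t\<le>l. smult ((-1) ^ t * real (r choose t)) ([:real l - real t, 1:] ^ m))"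

definition phi :: "nat \<Rightarrow> nat \<Rightarrow> real poly \<Rightarrow> real poly" where
  "phi r m S = (\<Sum>l<r. A_pol r m l * (S \<circ>\<^sub>p [:real l, 1:]))"

lemma poly_A_pol: "poly (A_pol r m l) x = A_poly r (Suc m) l x"
  by (simp add: A_pol_def A_poly_def poly_sum algebra_simps)

lemma poly_phi: "poly (phi r m S) x = (\<Sum>l<r. A_poly r (Suc m) l x * poly S (x + real l))"
  by (simp add: phi_def poly_sum poly_A_pol poly_pcompose add.commute)

lemma phi_sum_smult: "phi r m (\<Sum>i\<in>I. smult (c i) (S i)) = (\<Sum>i\<in>I. smult (c i) (phi r m (S i)))"
  by (rule poly_ext)
    (simp add: poly_phi poly_sum sum_distrib_left mult.left_commute, rule sum.swap)

lemma phi_diff: "phi r m (S - T) = phi r m S - phi r m T"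
  by (rule poly_ext) (simp add: poly_phi sum_subtractf algebra_simps)

text \<open>Reversing the sum exhibits the nodes \<open>x + real i\<close>, which do not depend on
  \<open>l\<close>; this prepares the Vandermonde factorization.\<close>

lemma A_poly_rev:
  "A_poly r (Suc m) l x = (-1) ^ (r - 1) * (\<Sum>i\<le>l. (-1) ^ (l - i) * real (r choose (l - i)) * (x + real i) ^ m)"
proof -
  have "(\<Sum>t\<le>l. (-1) ^ t * real (r choose t) * (x + real l - real t) ^ m) =
      (\<Sum>i\<le>l. (-1) ^ (l - i) * real (r choose (l - i)) * (x + real i) ^ m)"
    by (rule sum.reindex_bij_witness[of _ "\<lambda>i. l - i" "\<lambda>i. l - i"]) (auto simp: of_nat_diff algebra_simps)
  then show ?thesis
    by (simp add: A_poly_def)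
qed

text \<open>Up to sign, the sum for \<open>l = r\<close> is the r-th difference of x^m. It is the
  upper boundary term in the telescoping of \<open>fdiff_phi\<close>.\<close>

lemma A_poly_full:
  assumes "m < r"
  shows "A_poly r (Suc m) r x = 0"
proof -
  have "(\<Sum>i\<le>r. (-1) ^ (r - i) * real (r choose (r - i)) * (x + real i) ^ m) =
      poly ((fdiff ^^ r) (monom 1 m)) x"
    unfolding poly_fdiff_funpow
  proof (rule sum.cong)
    fix i assume "i \<in> {..r}"
    then have "i \<le> r"
      by simp
    then have "r choose (r - i) = r choose i" "(-1 :: real) ^ (r - i) = (-1) ^ (r + i)"
      by (simp_all add: binomial_symmetric[of i r] minus_one_power_iff)
    then show "(-1) ^ (r - i) * real (r choose (r - i)) * (x + real i) ^ m =
        (-1) ^ (r + i) * real (r choose i) * poly (monom 1 m) (x + real i)"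
      by (simp add: poly_monom)
  qed simp
  also have "(fdiff ^^ r) (monom 1 m) = 0"
    using assms by (intro fdiff_funpow_eq_0) (simp add: degree_monom_eq)
  finally show ?thesis
    by (simp add: A_poly_rev)
qed

lemma A_poly_shift:
  "A_poly r (Suc m) (Suc l) x =
     A_poly r (Suc m) l (x + 1) + (-1) ^ (r - 1) * ((-1) ^ Suc l * real (r choose Suc l) * x ^ m)"
  by (simp add: A_poly_def algebra_simps)

text \<open>Shifting x by 1 moves the term of index \<open>l\<close> to index \<open>l + 1\<close>,
  up to the last summand of \<open>A_poly\<close>. The sum telescopes, and the leftover summands
  form the r-th difference.\<close>

lemma fdiff_phi:
  assumes "m < r"
  shows "fdiff (phi r m S) = monom 1 m * (fdiff ^^ r) S"
proof (rule poly_ext)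
  fix x
  obtain k where r: "r = Suc k"
    using assms by (cases r) auto
  let ?a = "\<lambda>l. A_poly r (Suc m) l x * poly S (x + real l)"
  let ?e = "\<lambda>l. (-1) ^ k * ((-1) ^ l * real (r choose l) * x ^ m) * poly S (x + real l)"
  have "poly (fdiff (phi r m S)) x =
      (\<Sum>l<r. A_poly r (Suc m) l (x + 1) * poly S (x + 1 + real l)) - (\<Sum>l<r. ?a l)"
    by (simp add: poly_phi)
  also have "(\<Sum>l<r. A_poly r (Suc m) l (x + 1) * poly S (x + 1 + real l)) =
      (\<Sum>l<r. ?a (Suc l) - ?e (Suc l))"
    by (rule sum.cong) (auto simp: A_poly_shift r algebra_simps)
  also have "\<dots> - (\<Sum>l<r. ?a l) = (\<Sum>l<r. ?a (Suc l) - ?a l) - (\<Sum>l<r. ?e (Suc l))"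
    by (simp only: sum_subtractf)
  also have "(\<Sum>l<r. ?a (Suc l) - ?a l) = ?a r - ?a 0"
    by (rule sum_lessThan_telescope)
  \<comment> \<open>The upper end vanishes by \<open>A_poly_full\<close>; the lower end supplies the
    missing \<open>l = 0\<close> summand of the r-th difference.\<close>
  also have "\<dots> = - ?e 0"
    using A_poly_full[OF assms, of x] by (simp add: A_poly_def r)
  also have "- ?e 0 - (\<Sum>l<r. ?e (Suc l)) = - (\<Sum>l\<le>r. ?e l)"
    unfolding lessThan_Suc_atMost[symmetric] by (subst sum.lessThan_Suc_shift) simp
  also have "\<dots> = (\<Sum>l\<le>r. x ^ m * ((-1) ^ (r + l) * real (r choose l) * poly S (x + real l)))"
    unfolding sum_negf[symmetric] by (rule sum.cong) (auto simp: r power_add)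
  also have "\<dots> = poly (monom 1 m * (fdiff ^^ r) S) x"
    by (simp add: poly_fdiff_funpow poly_monom sum_distrib_left)
  finally show "poly (fdiff (phi r m S)) x = poly (monom 1 m * (fdiff ^^ r) S) x" .
qed

text \<open>The relations extend linearly to every polynomial of degree below \<open>n\<close>; a
  Lagrange polynomial vanishing at all nodes except \<open>x k\<close> isolates
  \<open>z k\<close>.\<close>

lemma vandermonde_injective:
  fixes x z :: "nat \<Rightarrow> 'a :: field"
  assumes inj: "inj_on x {..<n}" and 0: "\<And>m. m < n \<Longrightarrow> (\<Sum>i<n. x i ^ m * z i) = 0" and "k < n"
  shows "z k = 0"
proof -
  define q where "q = (\<Prod>j\<in>{..<n} - {k}. [:- x j, 1:])"
  have "degree q = n - 1"
    unfolding q_def using \<open>k < n\<close> by (subst degree_prod_eq_sum_degree) auto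
  then have deg: "degree q < n"
    using \<open>k < n\<close> by simp
  have "(\<Sum>i<n. poly q (x i) * z i) = (\<Sum>i<n. \<Sum>m\<le>degree q. coeff q m * (x i ^ m * z i))"
    by (simp add: poly_altdef sum_distrib_right mult.assoc)
  also have "\<dots> = (\<Sum>m\<le>degree q. coeff q m * (\<Sum>i<n. x i ^ m * z i))"
    by (subst sum.swap) (simp add: sum_distrib_left)
  also have "\<dots> = 0"
    using deg 0 by (intro sum.neutral) auto
  finally have "(\<Sum>i<n. poly q (x i) * z i) = 0" .
  moreover have "poly q (x i) * z i = 0" if "i \<in> {..<n} - {k}" for i
    using that by (auto simp: q_def poly_prod)
  then have "(\<Sum>i\<in>{..<n} - {k}. poly q (x i) * z i) = 0"
    by (rule sum.neutral[OF ballI])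
  then have "(\<Sum>i<n. poly q (x i) * z i) = poly q (x k) * z k"
    using \<open>k < n\<close> by (subst sum.remove[of _ k]) simp_all
  moreover have "poly q (x k) \<noteq> 0"
    using inj \<open>k < n\<close> by (auto simp: q_def poly_prod inj_on_def)
  ultimately show ?thesis
    by simp
qed

text \<open>The matrix \<open>A_poly r (m + 1) l x\<close> is a Vandermonde matrix times a unitriangular one.\<close>

lemma A_poly_injective:
  assumes 0: "\<And>m. m < r \<Longrightarrow> (\<Sum>l<r. A_poly r (Suc m) l x * y l) = 0" and "l < r"
  shows "y l = 0"
proof -
  define u where "u i l = (if i \<le> l then (-1) ^ (l - i) * real (r choose (l - i)) else 0)" for i l
  define z where "z i = (\<Sum>l<r. u i l * y l)" for i
  have "(\<Sum>i<r. (x + real i) ^ m * z i) = 0" if "m < r" for m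
  proof -
    have A: "A_poly r (Suc m) l x = (-1) ^ (r - 1) * (\<Sum>i<r. u i l * (x + real i) ^ m)" if "l < r" for l
    proof -
      have "(\<Sum>i\<le>l. (-1) ^ (l - i) * real (r choose (l - i)) * (x + real i) ^ m) =
          (\<Sum>i<r. u i l * (x + real i) ^ m)"
        using that by (intro sum.mono_neutral_cong_left) (auto simp: u_def)
      then show ?thesis
        by (simp add: A_poly_rev)
    qed
    have "0 = (\<Sum>l<r. A_poly r (Suc m) l x * y l)"
      using 0 that by simp
    also have "\<dots> = (\<Sum>l<r. \<Sum>i<r. (-1) ^ (r - 1) * (u i l * (x + real i) ^ m * y l))"
      by (rule sum.cong) (simp_all add: A sum_distrib_left sum_distrib_right mult.assoc)
    also have "\<dots> = (-1) ^ (r - 1) * (\<Sum>i<r. (x + real i) ^ m * z i)"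
      by (subst sum.swap) (simp add: z_def sum_distrib_left mult.assoc mult.left_commute)
    finally show ?thesis
      by simp
  qed
  then have z: "z i = 0" if "i < r" for i
    using that by (intro vandermonde_injective[of "\<lambda>i. x + real i" r z]) (auto simp: inj_on_def)
  show ?thesis
  proof (rule ccontr)
    assume "y l \<noteq> 0"
    \<comment> \<open>At the largest index of the support of \<open>y\<close>, unitriangularity of
      \<open>u\<close> gives \<open>z M = y M\<close>, contradicting \<open>z M = 0\<close>.\<close>
    define M where "M = Max {l. l < r \<and> y l \<noteq> 0}"
    have "M \<in> {l. l < r \<and> y l \<noteq> 0}"
      unfolding M_def using \<open>y l \<noteq> 0\<close> \<open>l < r\<close> by (intro Max_in) auto
    then have M: "M < r" "y M \<noteq> 0"
      by auto
    have "y l = 0" if "l < r" "l > M" for l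
      using that Max_ge[of "{l. l < r \<and> y l \<noteq> 0}" l] unfolding M_def by fastforce
    then have "u M l * y l = 0" if "l \<in> {..<r} - {M}" for l
      using that by (cases "l < M") (auto simp: u_def)
    then have "(\<Sum>l\<in>{..<r} - {M}. u M l * y l) = 0"
      by (rule sum.neutral[OF ballI])
    then have "z M = u M M * y M"
      unfolding z_def using M by (subst sum.remove[of _ M]) simp_all
    then show False
      using z M by (simp add: u_def)
  qed
qed

lemma phi_vanish_imp_vanish:
  assumes "\<And>m. m < r \<Longrightarrow> poly (phi r m S) x = 0" "l < r"
  shows "poly S (x + real l) = 0"
  using assms by (intro A_poly_injective[of r x "\<lambda>l. poly S (x + real l)" l]) (simp_all add: poly_phi)

lemma phi_eq_antidiff:
  assumes "m < r" "unit_integral (phi r m S) = 0"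
  shows "phi r m S = antidiff (monom 1 m * (fdiff ^^ r) S)"
  using assms by (intro antidiff_eqI[symmetric] fdiff_phi)

text \<open>The integrals are r linear functionals on the r-dimensional space of degree below r. If
  all vanish at p, then each \<Phi>_j is L 0 = 0 because \<Delta>^r p = 0, so p vanishes at 0, ...,
  r - 1 and is zero. Injectivity gives solvability.\<close>

lemma exists_unit_integral_phi:
  assumes "r > 0"
  obtains p where "degree p < r" "\<And>m. m < r \<Longrightarrow> unit_integral (phi r m p) = b m"
proof -
  let ?f = "\<lambda>(m, i). unit_integral (phi r m (monom 1 i))"
  define P where "P c = (\<Sum>i<r. smult (c i) (monom 1 i))" for c :: "nat \<Rightarrow> real"
  have degP: "degree (P c) < r" for c
    unfolding P_def using assms by (intro degree_sum_basis_less) (auto simp: degree_monom_eq)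
  have int: "unit_integral (phi r m (P c)) = (\<Sum>i<r. ?f (m, i) * c i)" for m c
    by (simp add: P_def phi_sum_smult unit_integral_sum unit_integral_smult mult.commute)
  have det: "det (mat r r ?f) \<noteq> 0"
  proof
    assume "det (mat r r ?f) = 0"
    then obtain c j where c: "j < r" "c j \<noteq> 0" and "\<forall>m<r. (\<Sum>i<r. ?f (m, i) * c i) = 0"
      unfolding det_mat_eq_0_iff by blast
    then have 0: "unit_integral (phi r m (P c)) = 0" if "m < r" for m
      using int that by metis
    have "phi r m (P c) = 0" if "m < r" for m
    proof -
      have "phi r m (P c) = antidiff (monom 1 m * (fdiff ^^ r) (P c))"
        using that 0 by (intro phi_eq_antidiff)
      also have "(fdiff ^^ r) (P c) = 0"
        using degP by (rule fdiff_funpow_eq_0)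
      finally show ?thesis
        by (simp add: antidiff_def)
    qed
    then have "poly (P c) (real l) = 0" if "l < r" for l
      using phi_vanish_imp_vanish[of r "P c" 0 l] that by simp
    then have "P c = 0"
      using degP[of c] by (intro poly_eqI_degree[of "real ` {..<r}"]) (auto simp: card_image)
    then have "c j = 0"
      unfolding P_def using c(1)
      by (intro degree_basis_independent[of r "monom 1" c]) (auto simp: degree_monom_eq monom_eq_0_iff)
    then show False
      using c by simp
  qed
  obtain c where c: "\<forall>m<r. (\<Sum>i<r. ?f (m, i) * c i) = b m"
    using det_mat_neq_0_imp_solvable[OF det, of b] by (elim exE)
  show ?thesis
  proof (rule that)
    show "degree (P c) < r"
      by (rule degP)
    show "unit_integral (phi r m (P c)) = b m" if "m < r" for m
      using c that by (simp only: int)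
  qed
qed

subsection \<open>Falling factorials\<close>

definition falling_pol :: "nat \<Rightarrow> nat \<Rightarrow> real poly" where
  "falling_pol D n = (\<Prod>i<n. [:- real i, real D:])"

lemma poly_falling_pol: "poly (falling_pol D n) x = falling_fact (real D * x) n"
  by (simp add: falling_pol_def falling_fact_def poly_prod mult.commute)

lemma falling_pol_neq_0: "D > 0 \<Longrightarrow> falling_pol D n \<noteq> 0"
  by (simp add: falling_pol_def)

lemma degree_falling_pol: "D > 0 \<Longrightarrow> degree (falling_pol D n) = n"
  unfolding falling_pol_def by (subst degree_prod_eq_sum_degree) auto

lemma poly_falling_pol_eq_0_iff:
  assumes "D > 0"
  shows "poly (falling_pol D n) (real w / real D) = 0 \<longleftrightarrow> w < n"
  using assms by (auto simp: falling_pol_def poly_prod)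

lemma falling_pol_dvd:
  assumes "D > 0" "\<And>w. w < n \<Longrightarrow> poly S (real w / real D) = 0"
  shows "falling_pol D n dvd S"
  using assms(2)
proof (induction n)
  case (Suc n)
  then obtain k where k: "S = falling_pol D n * k"
    by (auto elim: dvdE)
  have "poly S (real n / real D) = 0"
    using Suc.prems by simp
  \<comment> \<open>The new node is not a root of the factor already split off, so it must be a root
    of the cofactor.\<close>
  then have "poly k (real n / real D) = 0"
    using poly_falling_pol_eq_0_iff[OF \<open>D > 0\<close>, of n n] by (simp add: k)
  then have "[:- (real n / real D), 1:] dvd k"
    by (simp add: poly_eq_0_iff_dvd)
  then have "smult (real D) [:- (real n / real D), 1:] dvd k"
    using \<open>D > 0\<close> by (subst smult_dvd_iff) simp
  then have "[:- real n, real D:] dvd k"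
    using \<open>D > 0\<close> by simp
  moreover have "falling_pol D (Suc n) = falling_pol D n * [:- real n, real D:]"
    unfolding falling_pol_def by (rule prod.lessThan_Suc)
  ultimately show ?case
    unfolding k by (simp only: mult_dvd_mono dvd_refl)
qed (simp add: falling_pol_def)

subsection \<open>The two determinants\<close>

text \<open>This identifies a combination of Bernoulli entries within one column with a value of
  L(x^m Q).\<close>

lemma antidiff_monom_mult_sum:
  "antidiff (monom 1 m * (\<Sum>n<N. monom (a n) n)) =
     (\<Sum>n<N. smult (a n / real (n + m + 1)) (bern (n + m + 1)))"
proof (rule antidiff_eqI)
  have "fdiff (\<Sum>n<N. smult (a n / real (n + m + 1)) (bern (n + m + 1))) = (\<Sum>n<N. monom (a n) (n + m))"
    by (simp add: fdiff_sum fdiff_smult fdiff_bern smult_monom del: of_nat_Suc of_nat_add)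
  also have "\<dots> = monom 1 m * (\<Sum>n<N. monom (a n) n)"
    by (simp add: sum_distrib_left mult_monom add.commute)
  finally show "fdiff (\<Sum>n<N. smult (a n / real (n + m + 1)) (bern (n + m + 1))) =
    monom 1 m * (\<Sum>n<N. monom (a n) n)" .
  show "unit_integral (\<Sum>n<N. smult (a n / real (n + m + 1)) (bern (n + m + 1))) = 0"
    by (simp add: unit_integral_sum unit_integral_smult unit_integral_bern)
qed

text \<open>The nonzero weights \<open>d n\<close> will be the factors D^n carried by the rows of
  the Bernoulli matrix.\<close>

lemma ex_poly_iff_ex_coeffs:
  fixes d :: "nat \<Rightarrow> 'a :: field"
  assumes d: "\<And>n. d n \<noteq> 0" and "N > 0"
  shows "(\<exists>Q. Q \<noteq> 0 \<and> degree Q < N \<and> P Q) \<longleftrightarrow>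
         (\<exists>c. (\<exists>n<N. c n \<noteq> 0) \<and> P (\<Sum>n<N. monom (d n * c n) n))"
proof safe
  fix Q assume Q: "Q \<noteq> 0" "degree Q < N" "P Q"
  have "coeff Q i = 0" if "\<not> i < N" for i
    using that Q(2) by (intro coeff_eq_0) simp
  then have "Q = (\<Sum>n<N. monom (coeff Q n) n)"
    by (intro poly_eqI) (auto simp: coeff_sum)
  also have "\<dots> = (\<Sum>n<N. monom (d n * (coeff Q n / d n)) n)"
    using d by simp
  finally have "P (\<Sum>n<N. monom (d n * (coeff Q n / d n)) n)"
    using Q(3) by simp
  moreover have "coeff Q (degree Q) / d (degree Q) \<noteq> 0"
    using Q(1) d by simp
  ultimately show "\<exists>c. (\<exists>n<N. c n \<noteq> 0) \<and> P (\<Sum>n<N. monom (d n * c n) n)"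
    using Q(2) by (intro exI[of _ "\<lambda>n. coeff Q n / d n"] conjI) auto
next
  fix c n assume c: "n < N" "c n \<noteq> 0" "P (\<Sum>n<N. monom (d n * c n) n)"
  let ?Q = "\<Sum>n<N. monom (d n * c n) n"
  have "degree ?Q \<le> N - 1"
    by (intro degree_sum_le) (auto intro!: order.trans[OF degree_monom_le])
  moreover have "coeff ?Q n \<noteq> 0"
    using c d by (simp add: coeff_sum)
  then have "?Q \<noteq> 0"
    by force
  ultimately show "\<exists>Q. Q \<noteq> 0 \<and> degree Q < N \<and> P Q"
    using c(3) \<open>N > 0\<close> by (intro exI[of _ ?Q] conjI) auto
qed

lemma all_less_mult_iff:
  fixes D r :: nat
  assumes "D > 0"
  shows "(\<forall>c<r * D. P (c div D) (c mod D + 1)) \<longleftrightarrow> (\<forall>m<r. \<forall>v\<in>{1..D}. P m v)"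
proof safe
  fix m v assume *: "\<forall>c<r * D. P (c div D) (c mod D + 1)" "m < r" "v \<in> {1..D}"
  then obtain u where u: "v = Suc u" "u < D"
    by (cases v) auto
  then have "m * D + u < (m + 1) * D"
    by simp
  also have "\<dots> \<le> r * D"
    using *(2) by (intro mult_right_mono) auto
  finally show "P m v"
    using *(1)[rule_format, of "m * D + u"] u by simp
next
  fix c assume "\<forall>m<r. \<forall>v\<in>{1..D}. P m v" "c < r * D"
  then show "P (c div D) (c mod D + 1)"
    using assms by (simp add: less_mult_imp_div_less Suc_leI)
qed

lemma Delta_eq_0_iff:
  assumes "r > 0" "D > 0"
  shows "Delta r D = 0 \<longleftrightarrow> (\<exists>Q. Q \<noteq> 0 \<and> degree Q < r * D \<and>
    (\<forall>m<r. \<forall>v\<in>{1..D}. poly (antidiff (monom 1 m * Q)) (real v / real D) = 0))"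
proof -
  let ?N = "r * D"
  let ?f = "\<lambda>(c, n). let m = c div D; v = c mod D + 1
     in real D ^ (n + m) * (bernoulli_poly (n + m + 1) (real v / real D) / real (n + m + 1))"
  have entry: "(\<Sum>n<?N. ?f (c, n) * p n) = real D ^ (c div D) *
      poly (antidiff (monom 1 (c div D) * (\<Sum>n<?N. monom (real D ^ n * p n) n))) (real (c mod D + 1) / real D)"
    for c p
    unfolding antidiff_monom_mult_sum unfolding poly_sum poly_smult poly_bern sum_distrib_left Let_def
      case_prod_conv by (rule sum.cong) (simp_all add: power_add)
  \<comment> \<open>Transposing turns kernel vectors into relations between rows, whose coefficients
    are indexed by the degree \<open>n\<close>.\<close>
  have "Delta r D = det (transpose_mat (Delta_mat r D))"
    unfolding Delta_def by (rule det_transpose[of _ ?N, symmetric]) (simp add: Delta_mat_def)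
  also have "transpose_mat (Delta_mat r D) = mat ?N ?N ?f"
    by (rule eq_matI) (auto simp: Delta_mat_def)
  finally have "Delta r D = 0 \<longleftrightarrow>
      (\<exists>p. (\<exists>n<?N. p n \<noteq> 0) \<and> (\<forall>c<?N. (\<Sum>n<?N. ?f (c, n) * p n) = 0))"
    by (simp only: det_mat_eq_0_iff)
  also have "\<dots> \<longleftrightarrow> (\<exists>p. (\<exists>n<?N. p n \<noteq> 0) \<and> (\<forall>c<?N. real D ^ (c div D) *
      poly (antidiff (monom 1 (c div D) * (\<Sum>n<?N. monom (real D ^ n * p n) n))) (real (c mod D + 1) / real D) = 0))"
    by (simp only: entry)
  also have "\<dots> \<longleftrightarrow> (\<exists>p. (\<exists>n<?N. p n \<noteq> 0) \<and> (\<forall>m<r. \<forall>v\<in>{1..D}.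
        poly (antidiff (monom 1 m * (\<Sum>n<?N. monom (real D ^ n * p n) n))) (real v / real D) = 0))"
    using \<open>D > 0\<close> by (subst all_less_mult_iff[OF \<open>D > 0\<close>, symmetric]) (simp del: of_nat_add)
  also have "\<dots> \<longleftrightarrow> (\<exists>Q. Q \<noteq> 0 \<and> degree Q < ?N \<and>
      (\<forall>m<r. \<forall>v\<in>{1..D}. poly (antidiff (monom 1 m * Q)) (real v / real D) = 0))"
    using assms by (intro ex_poly_iff_ex_coeffs[symmetric]) auto
  finally show ?thesis .
qed

text \<open>The symmetry \<open>x \<mapsto> 1 - x\<close> trades the nodes \<open>1/D, \<dots>, D/D\<close> of the Bernoulli determinant
  for the nodes \<open>0/D, \<dots>, (D - 1)/D\<close>, which are those of the falling factorial \<open>(D x)\<^sub>D\<^sub>r\<close>.\<close>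

lemma Delta_eq_0_iff':
  assumes "r > 0" "D > 0"
  shows "Delta r D = 0 \<longleftrightarrow> (\<exists>Q. Q \<noteq> 0 \<and> degree Q < r * D \<and>
    (\<forall>m<r. \<forall>v<D. poly (antidiff (monom 1 m * Q)) (real v / real D) = 0))"
proof -
  \<comment> \<open>Replacing x by -x in \<open>Q\<close> replaces x by 1 - x in the
    antidifferences, up to sign, and so sends the node v/D to (D - v)/D.\<close>
  define R :: "real poly \<Rightarrow> real poly" where "R Q = Q \<circ>\<^sub>p [:0, -1:]" for Q
  have R: "R Q \<noteq> 0" "degree (R Q) = degree Q" if "Q \<noteq> 0" for Q
    using that by (auto simp: R_def pcompose_eq_0_iff degree_pcompose)
  have vanish: "poly (antidiff (monom 1 m * R Q)) (real v / real D) = 0"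
    if "poly (antidiff (monom 1 m * Q)) (real (D - v) / real D) = 0" "v \<le> D" for Q m v
    using that \<open>D > 0\<close> by (simp add: R_def poly_antidiff_monom_reflect of_nat_diff diff_divide_distrib)
  show ?thesis
    unfolding Delta_eq_0_iff[OF assms]
  proof safe
    fix Q assume Q: "Q \<noteq> 0" "degree Q < r * D"
      "\<forall>m<r. \<forall>v\<in>{1..D}. poly (antidiff (monom 1 m * Q)) (real v / real D) = 0"
    have "poly (antidiff (monom 1 m * R Q)) (real v / real D) = 0" if "m < r" "v < D" for m v
      using Q(3)[rule_format, of m "D - v"] that by (intro vanish) auto
    with Q R show "\<exists>Q. Q \<noteq> 0 \<and> degree Q < r * D \<and>
        (\<forall>m<r. \<forall>v<D. poly (antidiff (monom 1 m * Q)) (real v / real D) = 0)"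
      by (intro exI[of _ "R Q"]) simp
  next
    fix Q assume Q: "Q \<noteq> 0" "degree Q < r * D"
      "\<forall>m<r. \<forall>v<D. poly (antidiff (monom 1 m * Q)) (real v / real D) = 0"
    have "poly (antidiff (monom 1 m * R Q)) (real v / real D) = 0" if "m < r" "v \<in> {1..D}" for m v
      using Q(3)[rule_format, of m "D - v"] that by (intro vanish) auto
    with Q R show "\<exists>Q. Q \<noteq> 0 \<and> degree Q < r * D \<and>
        (\<forall>m<r. \<forall>v\<in>{1..D}. poly (antidiff (monom 1 m * Q)) (real v / real D) = 0)"
      by (intro exI[of _ "R Q"]) simp
  qed
qed

text \<open>These are the quotients of the S_t by the falling factorial (D x)_(D r).\<close>

definition cofactor_basis :: "nat \<Rightarrow> nat \<Rightarrow> real poly" where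
  "cofactor_basis r t = (if t = 0 then 1 else [:- real r, 1:] * [:- (real r / 2), 1:] ^ (t - 1))"

lemma cofactor_basis: "cofactor_basis r t \<noteq> 0 \<and> degree (cofactor_basis r t) = t"
  by (simp add: cofactor_basis_def degree_mult_eq degree_power_eq del: mult_pCons_left)

lemma I_entry_eq:
  "I_entry r D (Suc m) t = unit_integral (phi r m (cofactor_basis r t * falling_pol D (D * r)))"
proof -
  have "poly (cofactor_basis r t * falling_pol D (D * r)) x = S_poly r D t x" for x
    by (simp add: cofactor_basis_def S_poly_def poly_falling_pol poly_power algebra_simps)
  then have "Phi r D (Suc m) t = poly (phi r m (cofactor_basis r t * falling_pol D (D * r)))"
    by (simp add: fun_eq_iff Phi_def poly_phi)
  then show ?thesis
    by (simp add: I_entry_def unit_integral_def)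
qed

text \<open>The cofactors have degrees 0, ..., r - 1, so the combinations of the S_t are exactly the
  multiples of the falling factorial of degree below r D + r.\<close>

lemma Delta'_eq_0_iff:
  assumes "r > 0" "D > 0"
  shows "Delta' r D = 0 \<longleftrightarrow> (\<exists>S. S \<noteq> 0 \<and> degree S < r * D + r \<and> falling_pol D (D * r) dvd S \<and>
    (\<forall>m<r. unit_integral (phi r m S) = 0))"
proof -
  let ?F = "falling_pol D (D * r)"
  define T where "T c = (\<Sum>t<r. smult (c t) (cofactor_basis r t))" for c
  have F: "?F \<noteq> 0" "degree ?F = r * D"
    using \<open>D > 0\<close> by (simp_all add: falling_pol_neq_0 degree_falling_pol)
  have T_mult: "T c * ?F = (\<Sum>t<r. smult (c t) (cofactor_basis r t * ?F))" for c
    by (simp add: T_def sum_distrib_right)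
  have entry: "(\<Sum>t<r. I_entry r D (Suc m) t * c t) = unit_integral (phi r m (T c * ?F))" for m c
    unfolding T_mult I_entry_eq phi_sum_smult unit_integral_sum unit_integral_smult
    by (simp only: mult.commute)
  have "Delta' r D = 0 \<longleftrightarrow> (\<exists>c. (\<exists>t<r. c t \<noteq> 0) \<and> (\<forall>m<r. unit_integral (phi r m (T c * ?F)) = 0))"
    unfolding Delta'_def det_mat_eq_0_iff by (simp add: entry)
  also have "\<dots> \<longleftrightarrow> (\<exists>S. S \<noteq> 0 \<and> degree S < r * D + r \<and> ?F dvd S \<and>
      (\<forall>m<r. unit_integral (phi r m S) = 0))"
  proof safe
    fix c t assume c: "t < r" "c t \<noteq> 0" "\<forall>m<r. unit_integral (phi r m (T c * ?F)) = 0"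
    have "T c \<noteq> 0"
      using degree_basis_independent[of r "cofactor_basis r" c t] cofactor_basis c unfolding T_def by blast
    moreover have "degree (T c) < r"
      unfolding T_def using \<open>r > 0\<close> cofactor_basis by (intro degree_sum_basis_less) auto
    ultimately show "\<exists>S. S \<noteq> 0 \<and> degree S < r * D + r \<and> ?F dvd S \<and>
        (\<forall>m<r. unit_integral (phi r m S) = 0)"
      using F c(3) by (intro exI[of _ "T c * ?F"]) (auto simp: degree_mult_eq)
  next
    fix S assume S: "S \<noteq> 0" "degree S < r * D + r" "?F dvd S"
      "\<forall>m<r. unit_integral (phi r m S) = 0"
    then obtain q where q: "S = q * ?F"
      by (metis dvdE mult.commute)
    then have "q \<noteq> 0"
      using S(1) by auto
    then have "degree q < r"
      using S(2) F by (simp add: q degree_mult_eq)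
    then obtain c where c: "q = T c"
      using degree_basis_span[of r "cofactor_basis r" q] cofactor_basis unfolding T_def by blast
    then have "\<exists>t<r. c t \<noteq> 0"
      using \<open>q \<noteq> 0\<close> unfolding T_def by (metis (no_types, lifting) lessThan_iff smult_0_left sum.neutral)
    then show "\<exists>c. (\<exists>t<r. c t \<noteq> 0) \<and> (\<forall>m<r. unit_integral (phi r m (T c * ?F)) = 0)"
      using S(4) q c by blast
  qed
  finally show ?thesis .
qed

lemma Delta_eq_0_if_Delta'_eq_0:
  assumes "r > 0" "D > 0" "Delta' r D = 0"
  shows "Delta r D = 0"
proof -
  let ?F = "falling_pol D (D * r)"
  obtain S where S: "S \<noteq> 0" "degree S < r * D + r" "?F dvd S"
    and int: "\<And>m. m < r \<Longrightarrow> unit_integral (phi r m S) = 0"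
    using assms by (auto simp: Delta'_eq_0_iff)
  let ?Q = "(fdiff ^^ r) S"
  \<comment> \<open>Divisibility forces the degree of \<open>S\<close> to be at least r D, hence at
    least r, so its r-th difference cannot vanish.\<close>
  have "r \<le> r * D"
    using \<open>D > 0\<close> by simp
  also have "\<dots> \<le> degree S"
    using dvd_imp_degree_le[OF S(3,1)] \<open>D > 0\<close> by (simp add: degree_falling_pol mult.commute)
  finally have "\<not> degree S < r"
    by simp
  then have "?Q \<noteq> 0"
    using fdiff_funpow_eq_0D S(1) by blast
  moreover have "degree ?Q < r * D"
    using degree_fdiff_funpow[of r S] S(2) \<open>r \<le> r * D\<close> \<open>r > 0\<close> by linarith
  moreover have "poly (antidiff (monom 1 m * ?Q)) (real v / real D) = 0" if "m < r" "v < D" for m v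
  proof -
    \<comment> \<open>The point is (v + l D)/D with v + l D < r D, a root of the falling
      factorial.\<close>
    have "poly S (real v / real D + real l) = 0" if "l < r" for l
    proof -
      have "v + l * D < (l + 1) * D"
        using \<open>v < D\<close> by simp
      also have "\<dots> \<le> r * D"
        using that by (intro mult_right_mono) auto
      finally have "poly ?F (real (v + l * D) / real D) = 0"
        using \<open>D > 0\<close> by (subst poly_falling_pol_eq_0_iff) (auto simp: mult.commute)
      then have "poly S (real (v + l * D) / real D) = 0"
        using S(3) by (auto elim: dvdE)
      then show ?thesis
        using \<open>D > 0\<close> by (simp add: add_divide_distrib)
    qed
    then have "poly (phi r m S) (real v / real D) = 0"
      by (simp add: poly_phi)
    then show ?thesis
      using \<open>m < r\<close> int by (simp add: phi_eq_antidiff)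
  qed
  ultimately show ?thesis
    using assms by (subst Delta_eq_0_iff') blast+
qed

lemma Delta'_eq_0_if_Delta_eq_0:
  assumes "r > 0" "D > 0" "Delta r D = 0"
  shows "Delta' r D = 0"
proof -
  let ?F = "falling_pol D (D * r)"
  obtain Q where Q: "Q \<noteq> 0" "degree Q < r * D"
    and van: "\<And>m v. m < r \<Longrightarrow> v < D \<Longrightarrow> poly (antidiff (monom 1 m * Q)) (real v / real D) = 0"
    using assms by (auto simp: Delta_eq_0_iff')
  let ?S1 = "(antidiff ^^ r) Q"
  obtain p where p: "degree p < r"
    "\<And>m. m < r \<Longrightarrow> unit_integral (phi r m p) = unit_integral (phi r m ?S1)"
    using exists_unit_integral_phi[OF \<open>r > 0\<close>, of "\<lambda>m. unit_integral (phi r m ?S1)"] by blast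
  \<comment> \<open>Subtracting \<open>p\<close> makes all the integrals vanish and, as
    \<open>degree p < r\<close>, leaves the r-th difference equal to \<open>Q\<close>.\<close>
  define S where "S = ?S1 - p"
  have diff: "(fdiff ^^ n) (f - g) = (fdiff ^^ n) f - (fdiff ^^ n) g" for n f g
    by (induction n) (simp_all add: fdiff_diff)
  have SQ: "(fdiff ^^ r) S = Q"
    using p(1) by (simp add: S_def diff fdiff_funpow_antidiff fdiff_funpow_eq_0)
  have int: "unit_integral (phi r m S) = 0" if "m < r" for m
    using p(2) that by (simp add: S_def phi_diff unit_integral_diff)
  have "(fdiff ^^ r) 0 = 0"
    by (induction r) simp_all
  then have "S \<noteq> 0"
    using SQ Q(1) by auto
  moreover have "degree ?S1 < r * D + r"
    using degree_antidiff_funpow[of r Q] Q(2) by linarith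
  then have "degree S < r * D + r"
    unfolding S_def using p(1) by (intro degree_diff_less) auto
  moreover have "?F dvd S"
  proof (rule falling_pol_dvd[OF \<open>D > 0\<close>])
    fix w assume "w < D * r"
    \<comment> \<open>Division with remainder splits w/D into a node in [0, 1) and an integer shift
      below r, the form needed by \<open>phi_vanish_imp_vanish\<close>.\<close>
    then have "w div D < r" "w mod D < D"
      using \<open>D > 0\<close> by (simp_all add: less_mult_imp_div_less mult.commute)
    then have "poly (phi r m S) (real (w mod D) / real D) = 0" if "m < r" for m
      using phi_eq_antidiff[OF that int[OF that]] van[OF that] by (simp add: SQ)
    then have "poly S (real (w mod D) / real D + real (w div D)) = 0"
      using \<open>w div D < r\<close> by (rule phi_vanish_imp_vanish)
    moreover have "real w = real (w mod D) + real (w div D) * real D"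
      by (metis add.commute div_mult_mod_eq of_nat_add of_nat_mult)
    ultimately show "poly S (real w / real D) = 0"
      using \<open>D > 0\<close> by (simp add: add_divide_distrib)
  qed
  ultimately show ?thesis
    using assms int by (subst Delta'_eq_0_iff) blast+
qed

theorem corollary2p14:
  shows "(\<forall>r D :: nat. r \<ge> 1 \<longrightarrow> D \<ge> 1 \<longrightarrow> (Delta r D \<noteq> 0 \<longleftrightarrow> Delta' r D \<noteq> 0)) \<and>
         ((\<forall>r D :: nat. r \<ge> 1 \<longrightarrow> D \<ge> 1 \<longrightarrow> Delta r D \<noteq> 0) \<longleftrightarrow>
          (\<forall>r D :: nat. r \<ge> 1 \<longrightarrow> D \<ge> 1 \<longrightarrow> Delta' r D \<noteq> 0))"
proof -
  have "Delta r D = 0 \<longleftrightarrow> Delta' r D = 0" if "r \<ge> 1" "D \<ge> 1" for r D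
    using that Delta_eq_0_if_Delta'_eq_0[of r D] Delta'_eq_0_if_Delta_eq_0[of r D] by auto
  then show ?thesis
    by blast
qed

end
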